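(* Let $\varphi_1>1$ and let $f \in C^1[\varphi_1,\infty)$ be a real-valued function with $\lim_{\varphi\to\infty} f(\varphi)=0$. Assume that there exist positive constants $\overline{m}$ and $K$ such that, for all $\varphi \ge \varphi_1$, $$0 < f(\varphi) \le \overline{m}\, \varphi^{-1}, \qquad - K \varphi^{-1} \le f'(\varphi) \le 0.$$ Assume, moreover, that for each fixed $\varphi \ge \varphi_1$ the function $f'$ is not identically zero on $[\varphi,\varphi+2\pi)$. Let $\Gamma= \{ (f(\varphi)\cos \varphi,f(\varphi)\sin \varphi) : \varphi \ge \varphi_1 \}$. Then $\dim_{\rm B} \Gamma = 1$.
   Context: For a bounded set $\Gamma\subset\mathbf{R}^2$, the box-counting (Minkowski-Bouligand) dimension is $$\dim_{\rm B} \Gamma = 2 - \lim_{\varepsilon \to +0} \frac{\log|\Gamma_\varepsilon|}{\log \varepsilon},$$ where $\Gamma_\varepsilon = \{ (x,y) \in \mathbf{R}^2 : d((x,y),\Gamma) \le \varepsilon \}$, $d$ is the Euclidean distance, and $|\Gamma_\varepsilon|$ is the two-dimensional Lebesgue measure of $\Gamma_\varepsilon$. The assertion $\dim_{\rm B}\Gamma=d$ includes that the limit exists. *)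

theory Defs
  imports "HOL-Analysis.Analysis"
begin

text \<open>The plane is \<^typ>\<open>real \<times> real\<close>, whose metric is the Euclidean one.  The library sets
  \<^term>\<open>infdist p {} = 0\<close>, so the definitions below are meaningful for nonempty sets only.\<close>

definition closed_nbhd :: "(real \<times> real) set \<Rightarrow> real \<Rightarrow> (real \<times> real) set" where
  "closed_nbhd \<Gamma> \<epsilon> = {p. infdist p \<Gamma> \<le> \<epsilon>}"

text \<open>The box-counting dimension as a relation rather than a function: asserting it
  includes that \<open>\<Gamma>\<close> is bounded and that the limit exists.\<close>

definition has_box_dim :: "(real \<times> real) set \<Rightarrow> real \<Rightarrow> bool" where
  "has_box_dim \<Gamma> d \<longleftrightarrow> bounded \<Gamma> \<and>
     (\<exists>L. ((\<lambda>\<epsilon>. ln (measure lebesgue (closed_nbhd \<Gamma> \<epsilon>)) / ln \<epsilon>) \<longlongrightarrow> L) (at_right 0)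
          \<and> d = 2 - L)"

definition polar_curve :: "(real \<Rightarrow> real) \<Rightarrow> real \<Rightarrow> (real \<times> real) set" where
  "polar_curve f \<phi>\<^sub>1 = {(f \<phi> * cos \<phi>, f \<phi> * sin \<phi>) | \<phi>. \<phi> \<ge> \<phi>\<^sub>1}"

end

theory Submission
  imports Defs "HOL-Real_Asymp.Real_Asymp"
begin

text \<open>Reparametrized by \<open>\<phi> = exp t\<close>, the spiral is a Lipschitz curve whose distance to the origin
  is at most \<open>m * exp (- t)\<close>.  Hence the part with \<open>t\<close> beyond \<open>ln (1 / \<epsilon>)\<close> lies in one disc of
  radius of order \<open>\<epsilon>\<close>, and the rest is covered by about \<open>ln (1 / \<epsilon>) / \<epsilon>\<close> such discs, so that the
  area of the \<open>\<epsilon>\<close>-neighbourhood is of order at most \<open>\<epsilon> * ln (1 / \<epsilon>)\<close>.  It is at least of order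
  \<open>\<epsilon>\<close> because the spiral is connected and has more than one point.  The logarithmic factor
  does not affect the dimension.\<close>

section \<open>Measurability of neighbourhoods and areas of discs\<close>

lemma closed_closed_nbhd: "closed (closed_nbhd \<Gamma> \<epsilon>)"
  unfolding closed_nbhd_def by (intro closed_Collect_le continuous_intros)

lemma bounded_closed_nbhd:
  assumes "bounded \<Gamma>" "\<Gamma> \<noteq> {}"
  shows "bounded (closed_nbhd \<Gamma> \<epsilon>)"
proof -
  obtain B where B: "\<And>x. x \<in> \<Gamma> \<Longrightarrow> norm x \<le> B"
    using assms(1) by (auto simp: bounded_iff)
  \<comment> \<open>\<open>infdist\<close> is an infimum, not assumed attained here; the slack 1
    makes the bound strict, so that an actual point of \<Gamma> can be picked.\<close>
  have "norm p \<le> B + (\<epsilon> + 1)" if "p \<in> closed_nbhd \<Gamma> \<epsilon>" for p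
  proof -
    have "infdist p \<Gamma> < \<epsilon> + 1"
      using that by (simp add: closed_nbhd_def)
    then obtain x where x: "x \<in> \<Gamma>" "dist p x < \<epsilon> + 1"
      using assms(2) by (auto simp: infdist_notempty cINF_less_iff)
    have "norm p \<le> norm x + dist p x"
      by (metis dist_norm norm_triangle_sub)
    with x B[of x] show ?thesis by simp
  qed
  then show ?thesis unfolding bounded_iff by blast
qed

lemma lmeasurable_closed_nbhd:
  assumes "bounded \<Gamma>" "\<Gamma> \<noteq> {}"
  shows "closed_nbhd \<Gamma> \<epsilon> \<in> lmeasurable"
  by (intro lmeasurable_compact)
     (simp add: compact_eq_bounded_closed closed_closed_nbhd bounded_closed_nbhd assms)

lemma measure_lebesgue_disc:
  fixes c :: "real \<times> real"
  assumes "r \<ge> 0"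
  shows "measure lebesgue (cball c r) = pi * r\<^sup>2" "measure lebesgue (ball c r) = pi * r\<^sup>2"
  using assms by (simp_all add: content_cball content_ball eval_unit_ball_vol power2_eq_square)

section \<open>Area bounds for neighbourhoods of curves\<close>

text \<open>By connectedness the distance from \<open>p\<close> takes every value between 0 and
  \<open>dist p q\<close> on \<Gamma>. Points chosen at equally spaced distances are the centres of
  disjoint discs inside the neighbourhood, and their areas add up.\<close>

lemma measure_closed_nbhd_ge:
  assumes "connected \<Gamma>" "bounded \<Gamma>" "p \<in> \<Gamma>" "q \<in> \<Gamma>" "\<epsilon> > 0"
  shows "measure lebesgue (closed_nbhd \<Gamma> \<epsilon>) \<ge> dist p q * \<epsilon>"
proof -
  \<comment> \<open>The spacing \<open>3 * \<epsilon>\<close> exceeds the diameter of a disc, which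
    gives disjointness, and 3 is still less than \<open>pi\<close>: the indices 0 to
    \<open>N\<close> give \<open>N + 1\<close> discs of area more than
    \<open>3 * \<epsilon>\<^sup>2\<close> each, which sums to at least
    \<open>dist p q * \<epsilon>\<close>.\<close>
  define N where "N = nat \<lfloor>dist p q / (3 * \<epsilon>)\<rfloor>"
  have N_le: "real N * (3 * \<epsilon>) \<le> dist p q" and N_ge: "dist p q \<le> (real N + 1) * (3 * \<epsilon>)"
  proof -
    have "real N \<le> dist p q / (3 * \<epsilon>)"
      using assms(5) unfolding N_def by simp
    then show "real N * (3 * \<epsilon>) \<le> dist p q"
      using assms(5) by (simp add: pos_le_divide_eq)
    have "dist p q / (3 * \<epsilon>) \<le> real N + 1"
      unfolding N_def by linarith
    then show "dist p q \<le> (real N + 1) * (3 * \<epsilon>)"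
      using assms(5) by (simp add: pos_divide_le_eq)
  qed
  have "connected (dist p ` \<Gamma>)"
    by (intro connected_continuous_image continuous_intros assms(1))
  moreover have "0 \<in> dist p ` \<Gamma>" "dist p q \<in> dist p ` \<Gamma>"
    using assms(3,4) by (auto intro: rev_image_eqI)
  ultimately have "{0..dist p q} \<subseteq> dist p ` \<Gamma>"
    by (rule connected_contains_Icc)
  moreover have "real k * (3 * \<epsilon>) \<in> {0..dist p q}" if "k \<le> N" for k
    using order_trans[OF _ N_le, of "real k * (3 * \<epsilon>)"] that assms(5) by simp
  ultimately have "\<exists>y. y \<in> \<Gamma> \<and> dist p y = real k * (3 * \<epsilon>)" if "k \<le> N" for k
    using that by (metis imageE subsetD)
  then obtain y where y: "\<And>k. k \<le> N \<Longrightarrow> y k \<in> \<Gamma>" "\<And>k. k \<le> N \<Longrightarrow> dist p (y k) = real k * (3 * \<epsilon>)"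
    by metis
  have far: "dist (y j) (y k) \<ge> 3 * \<epsilon>" if "j < k" "k \<le> N" for j k
  proof -
    have "real k * (3 * \<epsilon>) - real j * (3 * \<epsilon>) \<le> dist (y j) (y k)"
      using y(2)[of j] y(2)[of k] that dist_triangle[of p "y k" "y j"] by simp
    moreover have "(real k - real j) * (3 * \<epsilon>) \<ge> 1 * (3 * \<epsilon>)"
      using that assms(5) by (intro mult_right_mono) auto
    ultimately show ?thesis by (simp add: algebra_simps)
  qed
  have disjoint: "ball (y j) \<epsilon> \<inter> ball (y k) \<epsilon> = {}" if "j < k" "k \<le> N" for j k
    using far[OF that] assms(5) by (intro disjoint_ballI) simp
  have disj: "disjoint_family_on (\<lambda>k. ball (y k) \<epsilon>) {..N}"
    unfolding disjoint_family_on_def by (metis atMost_iff disjoint inf_commute nat_neq_iff)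
  have "ball (y k) \<epsilon> \<subseteq> closed_nbhd \<Gamma> \<epsilon>" if "k \<le> N" for k
  proof
    fix x assume "x \<in> ball (y k) \<epsilon>"
    then have "dist x (y k) \<le> \<epsilon>" by (simp add: dist_commute)
    then show "x \<in> closed_nbhd \<Gamma> \<epsilon>"
      unfolding closed_nbhd_def using infdist_le[OF y(1)[OF that]] order_trans by blast
  qed
  then have "(\<Union>k\<le>N. ball (y k) \<epsilon>) \<subseteq> closed_nbhd \<Gamma> \<epsilon>"
    by blast
  then have "measure lebesgue (\<Union>k\<le>N. ball (y k) \<epsilon>) \<le> measure lebesgue (closed_nbhd \<Gamma> \<epsilon>)"
    using assms(2,3) by (intro measure_mono_fmeasurable lmeasurable_closed_nbhd) auto
  moreover have "measure lebesgue (\<Union>k\<le>N. ball (y k) \<epsilon>) = (\<Sum>k\<le>N. measure lebesgue (ball (y k) \<epsilon>))"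
    by (intro measure_finite_Union disj) (use emeasure_bounded_finite[OF bounded_ball] in \<open>auto simp: less_top\<close>)
  moreover have "\<dots> = (real N + 1) * (pi * \<epsilon>\<^sup>2)"
    using assms(5) by (simp add: measure_lebesgue_disc del: measure_completion)
  moreover have "dist p q * \<epsilon> \<le> (real N + 1) * (3 * \<epsilon>\<^sup>2)"
    using mult_right_mono[OF N_ge, of \<epsilon>] assms(5) by (simp add: power2_eq_square mult.assoc)
  moreover have "(real N + 1) * (3 * \<epsilon>\<^sup>2) \<le> (real N + 1) * (pi * \<epsilon>\<^sup>2)"
    using pi_gt3 by (intro mult_left_mono mult_right_mono) auto
  ultimately show ?thesis by linarith
qed

text \<open>The cut at \<open>ln (1 / \<epsilon>)\<close> is where the bound
  \<open>M * exp (- t)\<close> drops to \<open>M * \<epsilon>\<close>. Before the cut, parameters in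
  steps of \<epsilon> suffice, since the Lipschitz bound turns a step into a displacement of at most
  \<open>C * \<epsilon>\<close>.\<close>

lemma measure_closed_nbhd_le:
  fixes g :: "real \<Rightarrow> real \<times> real"
  assumes lip: "\<And>s t. s \<ge> t\<^sub>0 \<Longrightarrow> t \<ge> t\<^sub>0 \<Longrightarrow> dist (g s) (g t) \<le> C * dist s t"
    and decay: "\<And>t. t \<ge> t\<^sub>0 \<Longrightarrow> norm (g t) \<le> M * exp (- t)"
    and "t\<^sub>0 \<ge> 0" "C \<ge> 0" "M \<ge> 0" "0 < \<epsilon>" "\<epsilon> < 1"
  shows "measure lebesgue (closed_nbhd (g ` {t\<^sub>0..}) \<epsilon>)
           \<le> pi * (C + M + 2)\<^sup>2 * (\<epsilon> * (ln (1 / \<epsilon>) + 2))"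
proof -
  \<comment> \<open>One radius for both kinds of disc: a point of the neighbourhood is within
    \<open>2 * \<epsilon>\<close> of some point of the curve, which is within
    \<open>C * \<epsilon>\<close> of a grid point or within \<open>M * \<epsilon>\<close> of the
    origin.\<close>
  define R where "R = (C + M + 2) * \<epsilon>"
  define N where "N = nat \<lfloor>ln (1 / \<epsilon>) / \<epsilon>\<rfloor>"
  define U where "U = cball 0 R \<union> (\<Union>k\<le>N. cball (g (t\<^sub>0 + real k * \<epsilon>)) R)"
  have R: "R \<ge> 0" "C * \<epsilon> + 2 * \<epsilon> \<le> R" "M * \<epsilon> + 2 * \<epsilon> \<le> R"
    using assms(4-6) by (auto simp: R_def algebra_simps)
  have bounded: "bounded (g ` {t\<^sub>0..})"
  proof -
    have "norm (g t) \<le> M" if "t \<ge> t\<^sub>0" for t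
    proof -
      have "M * exp (- t) \<le> M * 1"
        using that assms(3,5) by (intro mult_left_mono) auto
      with decay[OF that] show ?thesis by simp
    qed
    then show ?thesis by (auto simp: bounded_iff)
  qed
  have sub: "closed_nbhd (g ` {t\<^sub>0..}) \<epsilon> \<subseteq> U"
  proof
    fix p assume "p \<in> closed_nbhd (g ` {t\<^sub>0..}) \<epsilon>"
    \<comment> \<open>Doubling \<epsilon> makes the inequality strict, so that some curve point
      realizes it.\<close>
    then have "infdist p (g ` {t\<^sub>0..}) < 2 * \<epsilon>"
      using assms(6) by (simp add: closed_nbhd_def)
    then obtain t where t: "t \<ge> t\<^sub>0" "dist p (g t) < 2 * \<epsilon>"
      by (auto simp: infdist_notempty cINF_less_iff)
    show "p \<in> U"
    proof (cases "ln (1 / \<epsilon>) \<le> t")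
      case True
      then have "exp (- t) \<le> exp (ln \<epsilon>)"
        unfolding exp_le_cancel_iff using assms(6) by (simp add: ln_div)
      then have "exp (- t) \<le> \<epsilon>"
        using assms(6) by simp
      then have "norm (g t) \<le> M * \<epsilon>"
        using decay[OF t(1)] assms(5) by (meson mult_left_mono order_trans)
      then have "dist 0 p \<le> R"
        using t(2) R(3) dist_triangle[of 0 p "g t"] by (simp add: dist_commute)
      then show ?thesis by (simp add: U_def)
    next
      case False
      \<comment> \<open>The index of the last grid parameter not after \<open>t\<close>; it is at
        most \<open>N\<close> because \<open>t\<^sub>0\<close> is nonnegative.\<close>
      define k where "k = nat \<lfloor>(t - t\<^sub>0) / \<epsilon>\<rfloor>"
      have "(t - t\<^sub>0) / \<epsilon> \<le> ln (1 / \<epsilon>) / \<epsilon>"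
        using False assms(3,6) by (intro divide_right_mono) auto
      then have "k \<le> N"
        unfolding k_def N_def by (intro nat_mono floor_mono)
      have "(t - t\<^sub>0) / \<epsilon> \<ge> 0"
        using t(1) assms(6) by simp
      then have "real k \<le> (t - t\<^sub>0) / \<epsilon>" "(t - t\<^sub>0) / \<epsilon> \<le> real k + 1"
        unfolding k_def by linarith+
      then have "real k * \<epsilon> \<le> t - t\<^sub>0" "t - t\<^sub>0 \<le> real k * \<epsilon> + \<epsilon>"
        using assms(6) by (simp_all add: field_simps)
      then have "dist (t\<^sub>0 + real k * \<epsilon>) t \<le> \<epsilon>"
        by (simp add: dist_real_def)
      then have "dist (g (t\<^sub>0 + real k * \<epsilon>)) (g t) \<le> C * \<epsilon>"
        using lip[of "t\<^sub>0 + real k * \<epsilon>" t] t(1) assms(4,6)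
        by (simp add: mult_left_mono order_trans)
      then have "dist (g (t\<^sub>0 + real k * \<epsilon>)) p \<le> R"
        using t(2) R(2) dist_triangle[of "g (t\<^sub>0 + real k * \<epsilon>)" p "g t"] by (simp add: dist_commute)
      then show ?thesis using \<open>k \<le> N\<close> by (auto simp: U_def)
    qed
  qed
  have "measure lebesgue (closed_nbhd (g ` {t\<^sub>0..}) \<epsilon>) \<le> measure lebesgue U"
    using sub lmeasurable_closed_nbhd[OF bounded, of \<epsilon>]
    by (intro measure_mono_fmeasurable) (auto simp: U_def intro!: fmeasurable.Un)
  also have "\<dots> \<le> measure lebesgue (cball 0 R :: (real \<times> real) set)
      + measure lebesgue (\<Union>k\<le>N. cball (g (t\<^sub>0 + real k * \<epsilon>)) R)"
    unfolding U_def by (intro measure_Un_le) auto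
  also have "measure lebesgue (\<Union>k\<le>N. cball (g (t\<^sub>0 + real k * \<epsilon>)) R)
      \<le> (\<Sum>k\<le>N. measure lebesgue (cball (g (t\<^sub>0 + real k * \<epsilon>)) R))"
    by (intro measure_UNION_le) auto
  also have "measure lebesgue (cball 0 R :: (real \<times> real) set)
      + (\<Sum>k\<le>N. measure lebesgue (cball (g (t\<^sub>0 + real k * \<epsilon>)) R)) = (real N + 2) * (pi * R\<^sup>2)"
    using R(1) by (simp add: measure_lebesgue_disc algebra_simps del: measure_completion)
  also have "\<dots> = pi * (C + M + 2)\<^sup>2 * (\<epsilon> * (real N * \<epsilon> + 2 * \<epsilon>))"
    by (simp add: R_def power2_eq_square algebra_simps)
  also have "\<dots> \<le> pi * (C + M + 2)\<^sup>2 * (\<epsilon> * (ln (1 / \<epsilon>) + 2))"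
  proof -
    \<comment> \<open>Nonnegativity, from \<epsilon> < 1, keeps \<open>nat\<close> from rounding a
      negative floor up to 0.\<close>
    have "0 \<le> ln (1 / \<epsilon>) / \<epsilon>"
      using assms(6,7) by simp
    then have "real N \<le> ln (1 / \<epsilon>) / \<epsilon>"
      unfolding N_def by simp
    then have "real N * \<epsilon> \<le> ln (1 / \<epsilon>)"
      using assms(6) by (simp add: pos_le_divide_eq)
    then show ?thesis
      using assms(6,7) by (intro mult_left_mono) auto
  qed
  finally show ?thesis by simp
qed

section \<open>Passage to the limit\<close>

text \<open>Since \<open>ln \<epsilon>\<close> is negative, division by it reverses the
  inequalities: the upper bound on \<open>V\<close> bounds the quotient from below. Both outer
  quotients tend to 1, because the logarithms of the constants and of
  \<open>ln (1 / \<epsilon>) + 2\<close> are negligible against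
  \<open>ln \<epsilon>\<close>.\<close>

lemma tendsto_ln_div_ln_1:
  fixes V :: "real \<Rightarrow> real"
  assumes "c > 0" "A > 0"
    and lower: "\<And>\<epsilon>. 0 < \<epsilon> \<Longrightarrow> \<epsilon> < 1 \<Longrightarrow> c * \<epsilon> \<le> V \<epsilon>"
    and upper: "\<And>\<epsilon>. 0 < \<epsilon> \<Longrightarrow> \<epsilon> < 1 \<Longrightarrow> V \<epsilon> \<le> A * (\<epsilon> * (ln (1 / \<epsilon>) + 2))"
  shows "((\<lambda>\<epsilon>. ln (V \<epsilon>) / ln \<epsilon>) \<longlongrightarrow> 1) (at_right 0)"
proof (rule real_tendsto_sandwich)
  have ev: "\<forall>\<^sub>F \<epsilon> in at_right 0. \<epsilon> \<in> {0<..<1::real}"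
    by (rule eventually_at_right_real) simp
  show "\<forall>\<^sub>F \<epsilon> in at_right 0. ln (A * (\<epsilon> * (ln (1 / \<epsilon>) + 2))) / ln \<epsilon> \<le> ln (V \<epsilon>) / ln \<epsilon>"
    using ev
  proof eventually_elim
    case (elim \<epsilon>)
    then have "0 < c * \<epsilon>" "ln \<epsilon> < 0" using assms(1) by auto
    with elim show ?case
      using lower[of \<epsilon>] upper[of \<epsilon>] by (intro divide_right_mono_neg ln_mono) auto
  qed
  show "\<forall>\<^sub>F \<epsilon> in at_right 0. ln (V \<epsilon>) / ln \<epsilon> \<le> ln (c * \<epsilon>) / ln \<epsilon>"
    using ev
  proof eventually_elim
    case (elim \<epsilon>)
    then have "0 < c * \<epsilon>" "ln \<epsilon> < 0" using assms(1) by auto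
    with elim show ?case
      using lower[of \<epsilon>] by (intro divide_right_mono_neg ln_mono) auto
  qed
  show "((\<lambda>\<epsilon>. ln (A * (\<epsilon> * (ln (1 / \<epsilon>) + 2))) / ln \<epsilon>) \<longlongrightarrow> 1) (at_right 0)"
    using assms(2) by real_asymp
  show "((\<lambda>\<epsilon>. ln (c * \<epsilon>) / ln \<epsilon>) \<longlongrightarrow> 1) (at_right 0)"
    using assms(1) by real_asymp
qed

section \<open>The spiral in the logarithm of the angle\<close>

text \<open>These are the radial and the angular direction in polar coordinates, scaled by
  \<open>a\<close>; they serve for the position and for the velocity of the spiral.\<close>

lemma norm_scaled_rotation:
  fixes a \<theta> :: real
  shows "norm (a * cos \<theta>, a * sin \<theta>) = \<bar>a\<bar>" "norm (- a * sin \<theta>, a * cos \<theta>) = \<bar>a\<bar>"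
  by (simp_all add: norm_Pair power_mult_distrib real_sqrt_abs flip: distrib_left)

lemma le_exp_if_ln_le: "0 < a \<Longrightarrow> ln a \<le> t \<Longrightarrow> a \<le> exp t" for a t :: real
  using exp_le_cancel_iff[of "ln a" t] by simp

text \<open>The chain rule multiplies the velocity by \<open>exp t\<close>, which is the angle
  itself and cancels the decay \<open>1 / \<phi>\<close> in both bounds. The radial part is then at
  most \<open>K\<close> and the angular part at most \<open>m\<close>, and the mean value inequality
  applies.\<close>

lemma exp_polar_lipschitz:
  fixes f f' :: "real \<Rightarrow> real"
  defines "g \<equiv> \<lambda>t. (f (exp t) * cos (exp t), f (exp t) * sin (exp t))"
  assumes deriv: "\<And>\<phi>. \<phi> \<ge> \<phi>\<^sub>1 \<Longrightarrow> (f has_real_derivative f' \<phi>) (at \<phi> within {\<phi>\<^sub>1..})"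
    and f: "\<And>\<phi>. \<phi> \<ge> \<phi>\<^sub>1 \<Longrightarrow> \<bar>f \<phi>\<bar> \<le> m / \<phi>"
    and f': "\<And>\<phi>. \<phi> \<ge> \<phi>\<^sub>1 \<Longrightarrow> \<bar>f' \<phi>\<bar> \<le> K / \<phi>"
    and "\<phi>\<^sub>1 > 0" "s \<ge> ln \<phi>\<^sub>1" "t \<ge> ln \<phi>\<^sub>1"
  shows "dist (g s) (g t) \<le> (K + m) * dist s t"
proof -
  define D where "D = (\<lambda>u. (f' (exp u) * exp u * cos (exp u), f' (exp u) * exp u * sin (exp u))
      + (- (f (exp u) * exp u) * sin (exp u), f (exp u) * exp u * cos (exp u)))"
  have in_dom: "exp u \<ge> \<phi>\<^sub>1" if "u \<ge> ln \<phi>\<^sub>1" for u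
    using le_exp_if_ln_le[OF assms(5) that] .
  have g': "(g has_vector_derivative D u) (at u within {ln \<phi>\<^sub>1..})" if "u \<in> {ln \<phi>\<^sub>1..}" for u
  proof -
    have "((f \<circ> exp) has_real_derivative f' (exp u) * exp u) (at u within {ln \<phi>\<^sub>1..})"
    proof (rule DERIV_image_chain)
      show "(f has_real_derivative f' (exp u)) (at (exp u) within exp ` {ln \<phi>\<^sub>1..})"
        using deriv[OF in_dom, of u] that in_dom by (force intro: DERIV_subset)
    qed (auto intro!: derivative_eq_intros)
    then have fe: "((\<lambda>t. f (exp t)) has_real_derivative f' (exp u) * exp u) (at u within {ln \<phi>\<^sub>1..})"
      by (simp add: o_def)
    show ?thesis
      unfolding g_def D_def
      by (rule has_vector_derivative_eq_rhs, rule has_vector_derivative_Pair)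
         (auto intro!: derivative_eq_intros fe simp: algebra_simps
            simp flip: has_real_derivative_iff_has_vector_derivative)
  qed
  have "norm (D u) \<le> K + m" if "u \<in> {ln \<phi>\<^sub>1..}" for u
  proof -
    have "\<bar>f' (exp u)\<bar> * exp u \<le> K" "\<bar>f (exp u)\<bar> * exp u \<le> m"
      using f[OF in_dom, of u] f'[OF in_dom, of u] that by (simp_all add: pos_le_divide_eq)
    moreover have "norm (D u) \<le> \<bar>f' (exp u) * exp u\<bar> + \<bar>f (exp u) * exp u\<bar>"
      unfolding D_def by (intro order_trans[OF norm_triangle_ineq]) (simp only: norm_scaled_rotation order_refl)
    ultimately show ?thesis by (simp add: abs_mult)
  qed
  \<comment> \<open>The mean value inequality is stated for operator norms, so the velocity is read
    as the linear map it induces.\<close>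
  then have "onorm (\<lambda>h. h *\<^sub>R D u) \<le> K + m" if "u \<in> {ln \<phi>\<^sub>1..}" for u
    using that by (intro onorm_le) (simp add: mult.commute mult_left_mono)
  then have "norm (g s - g t) \<le> (K + m) * norm (s - t)"
    using g' assms(6,7) unfolding has_vector_derivative_def
    by (intro differentiable_bound[of "{ln \<phi>\<^sub>1..}" g "\<lambda>u h. h *\<^sub>R D u"]) auto
  then show ?thesis by (simp add: dist_norm)
qed

theorem corollary1p2:
  fixes f f' :: "real \<Rightarrow> real" and \<phi>\<^sub>1 m K :: real
  assumes "\<phi>\<^sub>1 > 1"
    and "\<And>\<phi>. \<phi> \<ge> \<phi>\<^sub>1 \<Longrightarrow> (f has_real_derivative f' \<phi>) (at \<phi> within {\<phi>\<^sub>1..})"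
    and "continuous_on {\<phi>\<^sub>1..} f'"
    and "(f \<longlongrightarrow> 0) at_top"
    and "m > 0" and "K > 0"
    and "\<And>\<phi>. \<phi> \<ge> \<phi>\<^sub>1 \<Longrightarrow> 0 < f \<phi> \<and> f \<phi> \<le> m / \<phi>"
    and "\<And>\<phi>. \<phi> \<ge> \<phi>\<^sub>1 \<Longrightarrow> - K / \<phi> \<le> f' \<phi> \<and> f' \<phi> \<le> 0"
    and "\<And>\<phi>. \<phi> \<ge> \<phi>\<^sub>1 \<Longrightarrow> \<exists>\<theta>\<in>{\<phi>..<\<phi> + 2 * pi}. f' \<theta> \<noteq> 0"
  shows "has_box_dim (polar_curve f \<phi>\<^sub>1) 1"
proof -
  define g where "g = (\<lambda>t. (f (exp t) * cos (exp t), f (exp t) * sin (exp t)))"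
  define \<Gamma> where "\<Gamma> = polar_curve f \<phi>\<^sub>1"
  \<comment> \<open>The same curve in the original angle, where continuity and connectedness are
    immediate; \<open>g\<close> carries the metric estimates.\<close>
  define c where "c = (\<lambda>\<phi>. (f \<phi> * cos \<phi>, f \<phi> * sin \<phi>))"
  have \<Gamma>_c: "\<Gamma> = c ` {\<phi>\<^sub>1..}"
    by (auto simp: \<Gamma>_def polar_curve_def c_def)
  have "exp ` {ln \<phi>\<^sub>1..} = {\<phi>\<^sub>1..}"
  proof (intro equalityI subsetI)
    fix x assume "x \<in> {\<phi>\<^sub>1..}"
    then have "x = exp (ln x)" "ln x \<in> {ln \<phi>\<^sub>1..}"
      using assms(1) by auto
    then show "x \<in> exp ` {ln \<phi>\<^sub>1..}" by (rule image_eqI)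
  next
    fix x assume "x \<in> exp ` {ln \<phi>\<^sub>1..}"
    then show "x \<in> {\<phi>\<^sub>1..}" using assms(1) by (auto intro: le_exp_if_ln_le)
  qed
  then have \<Gamma>_g: "\<Gamma> = g ` {ln \<phi>\<^sub>1..}"
    unfolding \<Gamma>_c g_def c_def by (metis (no_types, lifting) image_cong image_image)
  have lip: "dist (g s) (g t) \<le> (K + m) * dist s t" if "s \<ge> ln \<phi>\<^sub>1" "t \<ge> ln \<phi>\<^sub>1" for s t
    unfolding g_def
    using assms(7,8) by (intro exp_polar_lipschitz[where f' = f', OF assms(2)] that) (use assms(1) in force)+
  have decay: "norm (g t) \<le> m * exp (- t)" if "t \<ge> ln \<phi>\<^sub>1" for t
    using assms(7)[OF le_exp_if_ln_le[OF _ that]] assms(1)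
    by (simp add: g_def norm_scaled_rotation exp_minus divide_inverse)
  have bounded: "bounded \<Gamma>"
    unfolding bounded_iff
  proof (intro exI ballI)
    fix x assume "x \<in> \<Gamma>"
    then obtain t where t: "t \<ge> ln \<phi>\<^sub>1" "x = g t" unfolding \<Gamma>_g by auto
    have "m * exp (- t) \<le> m * 1"
      using t(1) ln_gt_zero[OF assms(1)] assms(5) by (intro mult_left_mono) auto
    then show "norm x \<le> m" using decay[OF t(1)] t(2) by simp
  qed
  have "continuous_on {\<phi>\<^sub>1..} f"
    using assms(2) by (meson DERIV_continuous_on atLeast_iff)
  then have connected: "connected \<Gamma>"
    unfolding \<Gamma>_c c_def by (intro connected_continuous_image continuous_intros) auto
  \<comment> \<open>Half a turn apart the points lie on opposite rays from the origin, hence they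
    differ because \<open>f\<close> is positive.\<close>
  define p q where "p = c \<phi>\<^sub>1" and "q = c (\<phi>\<^sub>1 + pi)"
  have pq: "p \<in> \<Gamma>" "q \<in> \<Gamma>"
    by (auto simp: \<Gamma>_c p_def q_def)
  have "p \<noteq> q"
  proof
    assume "p = q"
    then have "(f \<phi>\<^sub>1 + f (\<phi>\<^sub>1 + pi)) * cos \<phi>\<^sub>1 = 0" "(f \<phi>\<^sub>1 + f (\<phi>\<^sub>1 + pi)) * sin \<phi>\<^sub>1 = 0"
      by (simp_all add: p_def q_def c_def algebra_simps)
    moreover have "f \<phi>\<^sub>1 + f (\<phi>\<^sub>1 + pi) > 0"
      using assms(7)[of \<phi>\<^sub>1] assms(7)[of "\<phi>\<^sub>1 + pi"] by simp
    ultimately show False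
      using sin_cos_squared_add[of \<phi>\<^sub>1] by simp
  qed
  have "((\<lambda>\<epsilon>. ln (measure lebesgue (closed_nbhd \<Gamma> \<epsilon>)) / ln \<epsilon>) \<longlongrightarrow> 1) (at_right 0)"
  proof (rule tendsto_ln_div_ln_1)
    show "dist p q > 0" using \<open>p \<noteq> q\<close> by simp
    \<comment> \<open>The constant of the upper bound with Lipschitz constant \<open>K + m\<close>
      and decay constant \<open>m\<close>.\<close>
    show "pi * (K + m + m + 2)\<^sup>2 > 0" using assms(5,6) by simp
    show "dist p q * \<epsilon> \<le> measure lebesgue (closed_nbhd \<Gamma> \<epsilon>)" if "0 < \<epsilon>" for \<epsilon>
      by (intro measure_closed_nbhd_ge connected bounded pq that)
    show "measure lebesgue (closed_nbhd \<Gamma> \<epsilon>) \<le> pi * (K + m + m + 2)\<^sup>2 * (\<epsilon> * (ln (1 / \<epsilon>) + 2))"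
      if "0 < \<epsilon>" "\<epsilon> < 1" for \<epsilon>
      unfolding \<Gamma>_g using assms(1,5,6) that
      by (intro measure_closed_nbhd_le lip decay) auto
  qed
  then show ?thesis
    unfolding has_box_dim_def \<Gamma>_def[symmetric] using bounded by (intro conjI exI[of _ 1]) auto
qed

end
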